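(* Let $\mathcal{N}$ be a neural network with $L$ layers and output dimension $d_L$, let $\Delta=(\Delta_1,\dots,\Delta_{d_L})$ with all $\Delta_j\ge 0$ be the output tolerance, let $\tilde{l}\in\{1,\dots,L\}$ and $\kappa\ge 0$. Let $(\mathsf{in},\mathsf{lb})\in\mathcal{D}_{train}$ be a training pair and let $[a,b]$ (with $a,b\in\mathbb{R}^{d_L}$) be an output bound for $\mathsf{in}$ subject to $(\tilde{l},\kappa)$-perturbation. Then for every output index $j\in\{1,\dots,d_L\}$ the symbolic loss satisfies $$e^{\langle \Delta,\tilde{l},\kappa\rangle}_{j}([a,b],\mathsf{lb})=\frac{1}{2}\left(e^{\Delta}_j(a_j,\mathsf{lb}_j)+e^{\Delta}_j(b_j,\mathsf{lb}_j)\right).$$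
   Context: A neural network $\mathcal{N}$ with $L$ layers is a sequence of functions $g^{(l)}:\mathbb{R}^{d_{l-1}}\to\mathbb{R}^{d_l}$, $l=1,\dots,L$. For $\mathsf{in}\in\mathbb{R}^{d_0}$, $f^{(l)}(\mathsf{in}):=g^{(l)}(\ldots g^{(2)}(g^{(1)}(\mathsf{in})))$, with $f^{(0)}(\mathsf{in}):=\mathsf{in}$. Subscripts denote vector components. The training set $\mathcal{D}_{train}$ is a finite set of pairs $(\mathsf{in},\mathsf{lb})\in\mathbb{R}^{d_0}\times\mathbb{R}^{d_L}$. Interval tolerance error: for real numbers $x,y$ and $\Delta_j\ge 0$, $e^{\Delta}_j(x,y):=0$ if $|x-y|\le\Delta_j$, and $e^{\Delta}_j(x,y):=\min\left(|x-(y-\Delta_j)|,\,|x-(y+\Delta_j)|\right)$ otherwise. Output bound: $[a,b]$ with $a,b\in\mathbb{R}^{d_L}$ is an output bound for $\mathsf{in}$ subject to $(\tilde{l},\kappa)$-perturbation if for every $\mathsf{fv}\in\mathbb{R}^{d_{\tilde{l}-1}}$ such that each component of $\mathsf{fv}$ differs from the corresponding component of $f^{(\tilde{l}-1)}(\mathsf{in})$ by at most $\kappa$ in absolute value, and for every $j$, one has $g^{(L)}_j(g^{(L-1)}(\ldots(g^{(\tilde{l})}(\mathsf{fv}))))\in[a_j,b_j]$. (It is only required to be an over-approximation of the set of perturbed outputs; in particular $a_j\le b_j$ for all $j$.) Symbolic loss: $e^{\langle \Delta,\tilde{l},\kappa\rangle}_{j}([a,b],\mathsf{lb}):=\mathrm{overflow}(I_1,I_2)$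 with $I_1=[a_j,b_j]$ and $I_2=[\mathsf{lb}_j-\Delta_j,\mathsf{lb}_j+\Delta_j]$, where $$\mathrm{overflow}(I_1,I_2)=\sum_{m=1}^{n}\mathrm{dist}\left(\tfrac12(p_m+q_m),\,I_2\right).$$ Here the sum is over the maximal disjoint intervals (connected components; there are $n\in\{0,1,2\}$ of them) of the set difference $I_1\setminus I_2$, $p_m\le q_m$ are the lower and upper end-points of the $m$-th such interval (whether or not they belong to it), and $\mathrm{dist}(x,I_2)$ is the shortest distance between the point $x$ and the points of $I_2$. An empty sum is $0$. *)

theory Defs
  imports
    "HOL-Analysis.Connected"
    "HOL-Analysis.Elementary_Metric_Spaces"
    "Jordan_Normal_Form.Matrix"
begin

text \<open>
  The layer widths \<open>d 0, \<dots>, d L\<close> vary within a network, so $\mathbb{R}^n$ is rendered as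
  \<open>carrier_vec n :: real vec set\<close>. Components are numbered from \<open>0\<close>: the output indices
  are the \<open>j < d L\<close>. Layers are numbered from \<open>1\<close> to \<open>L\<close>.
\<close>

definition neural_network :: "nat \<Rightarrow> (nat \<Rightarrow> nat) \<Rightarrow> (nat \<Rightarrow> real vec \<Rightarrow> real vec) \<Rightarrow> bool" where
  "neural_network L d g \<longleftrightarrow>
     (\<forall>l\<in>{1..L}. g l \<in> carrier_vec (d (l - 1)) \<rightarrow> carrier_vec (d l))"

text \<open>
  \<open>run_layers g m n v\<close> is \<open>g n (\<dots> (g (m + 1) (g m v)))\<close>, which is \<open>v\<close> if \<open>n < m\<close>.
\<close>

definition run_layers :: "(nat \<Rightarrow> real vec \<Rightarrow> real vec) \<Rightarrow> nat \<Rightarrow> nat \<Rightarrow> real vec \<Rightarrow> real vec" where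
  "run_layers g m n = fold g [m..<Suc n]"

definition layer_output :: "(nat \<Rightarrow> real vec \<Rightarrow> real vec) \<Rightarrow> nat \<Rightarrow> real vec \<Rightarrow> real vec" where
  "layer_output g l = run_layers g 1 l"

definition training_set :: "nat \<Rightarrow> (nat \<Rightarrow> nat) \<Rightarrow> (real vec \<times> real vec) set \<Rightarrow> bool" where
  "training_set L d D \<longleftrightarrow> finite D \<and> D \<subseteq> carrier_vec (d 0) \<times> carrier_vec (d L)"

definition interval_error :: "real \<Rightarrow> real \<Rightarrow> real \<Rightarrow> real" where
  "interval_error \<delta> x y =
     (if \<bar>x - y\<bar> \<le> \<delta> then 0 else min \<bar>x - (y - \<delta>)\<bar> \<bar>x - (y + \<delta>)\<bar>)"

definition output_bound ::
  "nat \<Rightarrow> (nat \<Rightarrow> nat) \<Rightarrow> (nat \<Rightarrow> real vec \<Rightarrow> real vec) \<Rightarrow> nat \<Rightarrow> real \<Rightarrow> real vec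
     \<Rightarrow> real vec \<Rightarrow> real vec \<Rightarrow> bool" where
  "output_bound L d g l \<kappa> inp a b \<longleftrightarrow>
     a \<in> carrier_vec (d L) \<and> b \<in> carrier_vec (d L) \<and>
     (\<forall>fv\<in>carrier_vec (d (l - 1)).
        (\<forall>i<d (l - 1). \<bar>fv $ i - layer_output g (l - 1) inp $ i\<bar> \<le> \<kappa>) \<longrightarrow>
        (\<forall>j<d L. run_layers g l L fv $ j \<in> {a $ j..b $ j}))"

text \<open>
  The maximal disjoint intervals of \<open>I1 - I2\<close> are its connected components; the end-points of a
  bounded nonempty interval \<open>C\<close> are \<open>Inf C\<close> and \<open>Sup C\<close>, whether or not they belong to \<open>C\<close>.
\<close>

definition overflow :: "real set \<Rightarrow> real set \<Rightarrow> real" where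
  "overflow I1 I2 = (\<Sum>C\<in>components (I1 - I2). infdist ((Inf C + Sup C) / 2) I2)"

text \<open>The perturbed layer and \<open>\<kappa>\<close> enter the loss only through the output bound \<open>[a, b]\<close>.\<close>

definition symbolic_loss :: "real vec \<Rightarrow> nat \<Rightarrow> real vec \<Rightarrow> real vec \<Rightarrow> real vec \<Rightarrow> real" where
  "symbolic_loss \<Delta> j a b lb = overflow {a $ j..b $ j} {lb $ j - \<Delta> $ j..lb $ j + \<Delta> $ j}"

end

theory Submission
  imports Defs
begin

text \<open>
  The unperturbed features are an admissible perturbation, so the output bound is a nonempty
  interval \<open>{p..q}\<close>. Removing \<open>{u..v}\<close> from it leaves at most a piece left of \<open>u\<close>, running from \<open>p\<close>
  to \<open>min q u\<close>, and a piece right of \<open>v\<close>. On either side of \<open>{u..v}\<close> the distance to \<open>{u..v}\<close> is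
  affine, so at the midpoint of a piece it is the mean of the distances at the two end-points.
\<close>

lemma infdist_atLeastAtMost_real:
  fixes x u v :: real
  assumes "u \<le> v"
  shows "infdist x {u..v} = max 0 (max (u - x) (x - v))"
proof (rule antisym)
  \<comment> \<open>Clamping \<open>x\<close> to \<open>{u..v}\<close> gives the nearest point; its
    distance is the upper bound.\<close>
  define z where "z = max u (min x v)"
  have "z \<in> {u..v}"
    using assms by (auto simp: z_def)
  then have "infdist x {u..v} \<le> dist x z"
    by (rule infdist_le)
  also have "dist x z = max 0 (max (u - x) (x - v))"
    using assms by (auto simp: z_def dist_real_def)
  finally show "infdist x {u..v} \<le> max 0 (max (u - x) (x - v))" .
  show "max 0 (max (u - x) (x - v)) \<le> infdist x {u..v}"
    using assms unfolding infdist_def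
    by (auto intro!: cINF_greatest simp: dist_real_def)
qed

text \<open>Outside the tolerance interval the nearest point is the nearer end-point, which the
  minimum selects. \<open>0 \<le> \<delta>\<close> keeps the interval nonempty.\<close>

lemma interval_error_eq_infdist:
  assumes "0 \<le> \<delta>"
  shows "interval_error \<delta> x y = infdist x {y - \<delta>..y + \<delta>}"
  using assms by (auto simp: interval_error_def infdist_atLeastAtMost_real)

text \<open>A connected subset of \<open>A \<union> B\<close> cannot meet both of the disjoint open
  sets \<open>U\<close> and \<open>V\<close>, so it lies in \<open>A\<close> or in \<open>B\<close>.
  Subtracting \<open>{{}}\<close> allows either piece to be missing.\<close>

lemma components_Un_separated:
  assumes UV: "open U" "open V" "U \<inter> V = {}"
    and AB: "A \<subseteq> U" "B \<subseteq> V" "connected A" "connected B"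
  shows "components (A \<union> B) = {A, B} - {{}}"
proof -
  have split: "C \<subseteq> A \<or> C \<subseteq> B" if "connected C" "C \<subseteq> A \<union> B" for C
  proof -
    have "U \<inter> C = {} \<or> V \<inter> C = {}"
      using UV AB that by (intro connectedD) auto
    then show ?thesis
      using AB that by blast
  qed
  have "A \<inter> B = {}"
    using UV AB by blast
  have "C \<in> {A, B} - {{}}" if "C \<in> components (A \<union> B)" for C
  proof -
    have C: "C \<noteq> {}" "C \<subseteq> A \<union> B" "connected C"
      "\<And>E. E \<noteq> {} \<Longrightarrow> C \<subseteq> E \<Longrightarrow> E \<subseteq> A \<union> B \<Longrightarrow> connected E \<Longrightarrow> E = C"
      using that unfolding in_components_maximal by blast+
    with split[of C] C(4)[of A] C(4)[of B] AB show ?thesis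
      by blast
  qed
  moreover have "C \<in> components (A \<union> B)" if C: "C \<in> {A, B} - {{}}" for C
    unfolding in_components_maximal
  proof (intro conjI allI impI)
    fix E assume "E \<noteq> {} \<and> C \<subseteq> E \<and> E \<subseteq> A \<union> B \<and> connected E"
    with split[of E] C \<open>A \<inter> B = {}\<close> show "E = C"
      by blast
  qed (use C AB in auto)
  ultimately show ?thesis
    by blast
qed

lemma overflow_atLeastAtMost:
  fixes p q u v :: real
  assumes "p \<le> q" "u \<le> v"
  shows "overflow {p..q} {u..v} = (infdist p {u..v} + infdist q {u..v}) / 2"
proof -
  define A where "A = {p..q} \<inter> {..<u}"
  define B where "B = {p..q} \<inter> {v<..}"
  define h where "h C = infdist ((Inf C + Sup C) / 2) {u..v}" for C
  have "{p..q} - {u..v} = A \<union> B"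
    by (auto simp: A_def B_def)
  moreover have "components (A \<union> B) = {A, B} - {{}}"
    using assms
    by (intro components_Un_separated[of "{..<u}" "{v<..}"])
      (auto simp: A_def B_def intro!: connectedI_interval)
  ultimately have "overflow {p..q} {u..v} = (\<Sum>C\<in>{A, B} - {{}}. h C)"
    by (simp add: overflow_def h_def)
  also have "A \<inter> B = {}"
    using assms by (auto simp: A_def B_def)
  \<comment> \<open>An empty side is no component and must count as \<open>0\<close>, whatever
    \<open>h {}\<close> is. Disjointness allows \<open>A = B\<close> only when both are empty, so no
    term is lost when the set collapses.\<close>
  then have "(\<Sum>C\<in>{A, B} - {{}}. h C)
      = (if A = {} then 0 else h A) + (if B = {} then 0 else h B)"
    by (cases "A = {}"; cases "B = {}"; cases "A = B") (auto simp: insert_Diff_if)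
  \<comment> \<open>If \<open>q < u\<close>, the midpoint averages two positive distances to
    \<open>u\<close>. Otherwise the piece is half-open with supremum \<open>u\<close>, and the
    vanishing second summand stands for that end-point.\<close>
  also have "(if A = {} then 0 else h A) = (max 0 (u - p) + max 0 (u - q)) / 2"
  proof (cases "p < u")
    case True
    then have "A = (if q < u then {p..q} else {p..<u})"
      by (auto simp: A_def)
    then show ?thesis
      using True assms by (auto simp: h_def infdist_atLeastAtMost_real field_simps)
  next
    case False
    then have "A = {}"
      by (auto simp: A_def)
    with False assms show ?thesis
      by simp
  qed
  also have "(if B = {} then 0 else h B) = (max 0 (p - v) + max 0 (q - v)) / 2"
  proof (cases "v < q")
    case True
    then have "B = (if v < p then {p..q} else {v<..q})"
      by (auto simp: B_def)
    then show ?thesis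
      using True assms by (auto simp: h_def infdist_atLeastAtMost_real field_simps)
  next
    case False
    then have "B = {}"
      by (auto simp: B_def)
    with False assms show ?thesis
      by simp
  qed
  \<comment> \<open>Since \<open>u \<le> v\<close>, at most one of \<open>u - x\<close> and
    \<open>x - v\<close> is positive, so their positive parts add up to the distance of
    \<open>x\<close> from \<open>{u..v}\<close>.\<close>
  also have "(max 0 (u - p) + max 0 (u - q)) / 2 + (max 0 (p - v) + max 0 (q - v)) / 2
      = (infdist p {u..v} + infdist q {u..v}) / 2"
    using assms by (auto simp: infdist_atLeastAtMost_real max_def field_simps)
  finally show ?thesis .
qed

lemma layer_output_carrier:
  assumes "neural_network L d g" "x \<in> carrier_vec (d 0)" "n \<le> L"
  shows "layer_output g n x \<in> carrier_vec (d n)"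
  using \<open>n \<le> L\<close>
proof (induction n)
  case 0
  then show ?case
    using assms by (simp add: layer_output_def run_layers_def)
next
  case (Suc n)
  have "g (Suc n) \<in> carrier_vec (d n) \<rightarrow> carrier_vec (d (Suc n))"
    using assms(1) Suc.prems by (force simp: neural_network_def)
  moreover have "layer_output g (Suc n) x = g (Suc n) (layer_output g n x)"
    by (simp add: layer_output_def run_layers_def)
  ultimately show ?case
    using Suc by auto
qed

lemma output_bound_le:
  assumes "neural_network L d g" "inp \<in> carrier_vec (d 0)" "l \<in> {1..L}" "0 \<le> \<kappa>"
    and "output_bound L d g l \<kappa> inp a b" "j < d L"
  shows "a $ j \<le> b $ j"
proof -
  have "layer_output g (l - 1) inp \<in> carrier_vec (d (l - 1))"
    using assms by (intro layer_output_carrier) auto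
  \<comment> \<open>Here \<open>fv\<close> is the unperturbed output of layer \<open>l - 1\<close>:
    its deviation is \<open>0\<close>, within \<open>\<kappa>\<close>.\<close>
  then have "run_layers g l L (layer_output g (l - 1) inp) $ j \<in> {a $ j..b $ j}"
    using assms unfolding output_bound_def by simp
  then show ?thesis
    by auto
qed

theorem lemma3:
  fixes L l j :: nat
    and d :: "nat \<Rightarrow> nat"
    and g :: "nat \<Rightarrow> real vec \<Rightarrow> real vec"
    and D :: "(real vec \<times> real vec) set"
    and \<Delta> inp lb a b :: "real vec"
    and \<kappa> :: real
  assumes "neural_network L d g"
    and "training_set L d D"
    and "\<Delta> \<in> carrier_vec (d L)"
    and "\<forall>i<d L. 0 \<le> \<Delta> $ i"
    and "l \<in> {1..L}"
    and "0 \<le> \<kappa>"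
    and "(inp, lb) \<in> D"
    and "output_bound L d g l \<kappa> inp a b"
    and "j < d L"
  shows "symbolic_loss \<Delta> j a b lb
    = 1 / 2 * (interval_error (\<Delta> $ j) (a $ j) (lb $ j) + interval_error (\<Delta> $ j) (b $ j) (lb $ j))"
proof -
  have "inp \<in> carrier_vec (d 0)"
    using assms(2,7) by (auto simp: training_set_def)
  then have "a $ j \<le> b $ j"
    using assms by (intro output_bound_le)
  moreover have "0 \<le> \<Delta> $ j"
    using assms(4,9) by simp
  ultimately show ?thesis
    by (simp add: symbolic_loss_def overflow_atLeastAtMost interval_error_eq_infdist)
qed

end
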